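(* Let $V(x)=V_S(x)+\|g(x)\|F(x)$ be a conical potential on $\mathbb{R}^d$ with $\Lambda=\{g=0\}$, and let $\nu$ be the measure on $\mathbb{R}\times ES\Lambda$ describing the mass concentration on $T^*\Lambda$ of a Wigner measure $\mu$ of solutions of the Schrödinger equation with potential $V$ (see context). If for some $\sigma\in\Lambda$ one has $$\left\|F(\sigma)\,{}^t\nabla g(\sigma)\right\|_{\mathcal{L}(N_\sigma\Lambda)}<\left\|\partial_\rho V_S(\sigma)\right\|_{N_\sigma\Lambda},$$ then there exists a neighbourhood $\Gamma\subset\Lambda$ of $\sigma$ such that $\nu=0$ over $\mathbb{R}\times ES\Gamma$, where $ES\Gamma$ has fibres $ES_\sigma\Gamma=T^*_\sigma\Gamma\oplus\left(N_\sigma\Gamma/\mathbb{R}_*^+\right)$.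
   Context: Conical potential: $1\le p\le d$ and $V(x)=V_S(x)+\|g(x)\|F(x)$ is real-valued on $\mathbb{R}^d$, where: (i) $V$ and $V_S$ each satisfy the Kato–Rellich conditions: continuous with at most quadratic growth, i.e. $|V(x)|,|V_S(x)|\le C(1+\|x\|^2)$; (ii) $F,V_S\in C^\infty(\mathbb{R}^d)$ and there is a non-decreasing positive polynomial $\mathfrak{p}$, with $\mathfrak{p}(x+y)\le K(\mathfrak{p}(x)+\mathfrak{p}(y))$ for some $K\ge 1$, that bounds $F$, $V_S$ and $\nabla F$; (iii) $g:\mathbb{R}^d\to\mathbb{R}^p$ is smooth, $\nabla g$ has full rank, and $\Lambda=\{g=0\}\ne\emptyset$. $\Psi^\varepsilon$ solves $i\varepsilon\partial_t\Psi_t^\varepsilon=-\frac{\varepsilon^2}{2}\Delta\Psi_t^\varepsilon+V\Psi_t^\varepsilon$ with $\|\Psi_0^\varepsilon\|_{L^2}=1$. A Wigner measure $\mu$ of $(\Psi^\varepsilon)$ is a positive measure on $\mathbb{R}\times\mathbb{R}^{2d}$ with $\int\Xi(t)\langle W^{\varepsilon_k}\Psi_t^{\varepsilon_k},a\rangle dt\to\int\Xi a\,d\mu$ along some $\varepsilon_k\to0$, for all $a\in C_0^\infty(\mathbb{R}^{2d}),\Xi\in C_0^\infty(\mathbb{R})$, where $W^\varepsilon\Psi(x,\xi)=\frac{1}{(2\pi\varepsilon)^d}\int e^{\frac{i}{\varepsilon}y\cdot\xi}\Psi(x-\frac y2)\overline{\Psi(x+\frac y2)}dy$. Geometry: $T_\sigma^*\Lambda=\ker\nabla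 g(\sigma)$; $N_\sigma\Lambda$ and $N^*_\sigma\Lambda$ are identified with $(\ker\nabla g(\sigma))^\perp$; $T^*\Lambda$ is identified with $\Omega=\{(x,\xi):g(x)=0,\nabla g(x)\xi=0\}$; near $\Lambda$, phase space points have coordinates $(\sigma,\zeta,\eta,\rho)$ with $\sigma\in\Lambda$, $\rho\in N_\sigma\Lambda$ describing the position and $\zeta\in T^*_\sigma\Lambda$, $\eta\in N^*_\sigma\Lambda$ the momentum. $\partial_\rho V_S(\sigma)$ is the normal gradient of $V_S$ (orthogonal projection of $\nabla V_S(\sigma)$ on $N_\sigma\Lambda$). A class of $\rho\neq0$ in $N_\sigma\Lambda/\mathbb{R}^+_*$ is identified with the unit vector $\omega=\nabla g(\sigma)\rho/\|\nabla g(\sigma)\rho\|\in\mathbb{R}^p$; $\|F(\sigma)\,{}^t\nabla g(\sigma)\|_{\mathcal{L}(N_\sigma\Lambda)}$ is the operator norm of $F(\sigma)\,{}^t\nabla g(\sigma):\mathbb{R}^p\to N_\sigma\Lambda$ ($\mathbb{R}^p$ being the coordinate space of $N_\sigma\Lambda$). The measure $\nu$: $ES\Lambda$ is the bundle over $\Lambda$ with fibres $ES_\sigma\Lambda=T_\sigma^*\Lambda\oplus(N_\sigma\Lambda/\mathbb{R}_*^+)$, and $\nu$ is the positive measure on $\mathbb{R}\times ES\Lambda$ such that $\mathbf{1}_{T^*\Lambda}\mu=\delta(\rho)\otimes\delta(\eta)\otimes\int_{N_\sigma\Lambda/\mathbb{R}_*^+}\nu(t,\sigma,\zeta,d\omega)$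 and satisfying the asymmetry condition $\int_{N_\sigma\Lambda/\mathbb{R}_*^+}\left(\partial_\rho V_S(\sigma)+F(\sigma)\,{}^t\nabla g(\sigma)\omega\right)\nu(t,\sigma,\zeta,d\omega)=0$ in $\mathcal{D}'(\mathbb{R}\times T^*\Lambda)$. *)

theory Defs
  imports
    "HOL-Analysis.Analysis"
    "HOL-Computational_Algebra.Polynomial"
begin

subsection \<open>Smooth functions, test functions, differential operators\<close>

primrec Ck :: "nat \<Rightarrow> ('a::euclidean_space \<Rightarrow> 'b::real_normed_vector) \<Rightarrow> bool" where
  "Ck 0 f \<longleftrightarrow> continuous_on UNIV f"
| "Ck (Suc k) f \<longleftrightarrow>
     (\<forall>x. f differentiable (at x)) \<and> (\<forall>v. Ck k (\<lambda>x. frechet_derivative f (at x) v))"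

definition smooth :: "('a::euclidean_space \<Rightarrow> 'b::real_normed_vector) \<Rightarrow> bool" where
  "smooth f \<longleftrightarrow> (\<forall>k. Ck k f)"

definition test_function :: "('a::euclidean_space \<Rightarrow> 'b::real_normed_vector) \<Rightarrow> bool" where
  "test_function f \<longleftrightarrow> smooth f \<and> compact (closure {x. f x \<noteq> 0})"

definition grad :: "((real^'d) \<Rightarrow> real) \<Rightarrow> real^'d \<Rightarrow> real^'d" where
  "grad f x = (\<chi> i. frechet_derivative f (at x) (axis i 1))"

definition laplacian :: "('a::euclidean_space \<Rightarrow> 'b::real_normed_vector) \<Rightarrow> 'a \<Rightarrow> 'b" where
  "laplacian f x =
     (\<Sum>b\<in>Basis. frechet_derivative (\<lambda>y. frechet_derivative f (at y) b) (at x) b)"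


subsection \<open>Conical potentials\<close>

definition quadratic_growth :: "('a::real_normed_vector \<Rightarrow> real) \<Rightarrow> bool" where
  "quadratic_growth V \<longleftrightarrow>
     continuous_on UNIV V \<and> (\<exists>C. \<forall>x. \<bar>V x\<bar> \<le> C * (1 + (norm x)\<^sup>2))"

text \<open>
  The dominating polynomial is a one-variable polynomial evaluated at the norm of the position,
  so positivity, monotonicity and quasi-subadditivity are required on the half-line only.
\<close>

definition admissible_bound :: "real poly \<Rightarrow> bool" where
  "admissible_bound P \<longleftrightarrow>
     (\<forall>r\<ge>0. 0 < poly P r) \<and> mono_on {0..} (poly P) \<and>
     (\<exists>K\<ge>1. \<forall>r\<ge>0. \<forall>s\<ge>0. poly P (r + s) \<le> K * (poly P r + poly P s))"

definition conical_potential ::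
  "((real^'d) \<Rightarrow> real) \<Rightarrow> ((real^'d) \<Rightarrow> real) \<Rightarrow> ((real^'d) \<Rightarrow> real) \<Rightarrow> ((real^'d) \<Rightarrow> real^'p) \<Rightarrow> bool"
where
  "conical_potential V VS F g \<longleftrightarrow>
     CARD('p) \<le> CARD('d) \<and>
     (\<forall>x. V x = VS x + norm (g x) * F x) \<and>
     quadratic_growth V \<and> quadratic_growth VS \<and>
     smooth F \<and> smooth VS \<and>
     (\<exists>P. admissible_bound P \<and>
        (\<forall>x. \<bar>F x\<bar> \<le> poly P (norm x) \<and> \<bar>VS x\<bar> \<le> poly P (norm x) \<and>
             norm (grad F x) \<le> poly P (norm x))) \<and>
     smooth g \<and> (\<forall>x. rank (jacobian g (at x)) = CARD('p)) \<and>
     {x. g x = 0} \<noteq> {}"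


subsection \<open>Solutions of the Schroedinger equation and their Wigner measures\<close>

definition square_integrable :: "('a::euclidean_space \<Rightarrow> complex) \<Rightarrow> bool" where
  "square_integrable u \<longleftrightarrow>
     u \<in> borel_measurable lborel \<and> integrable lborel (\<lambda>x. (cmod (u x))\<^sup>2)"

text \<open>
  Solutions are continuous in time with values in the space of square integrable functions, and
  the equation holds in the sense of distributions in the position variable at every time; no
  finiteness of the energy is required.  Since \<open>V\<close> is at most quadratic, the Hamiltonian is essentially
  self-adjoint on test functions, so these are exactly the orbits of the unitary propagator.
\<close>

definition schroedinger_solution ::
  "real \<Rightarrow> ((real^'d) \<Rightarrow> real) \<Rightarrow> (real \<Rightarrow> real^'d \<Rightarrow> complex) \<Rightarrow> bool"
where
  "schroedinger_solution \<epsilon> V \<psi> \<longleftrightarrow>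
     (\<forall>t. square_integrable (\<psi> t)) \<and>
     (\<forall>s. ((\<lambda>t. LINT x|lborel. (cmod (\<psi> t x - \<psi> s x))\<^sup>2) \<longlongrightarrow> 0) (at s)) \<and>
     (\<forall>\<phi> :: real^'d \<Rightarrow> complex. test_function \<phi> \<longrightarrow>
        (\<forall>t. \<exists>D. ((\<lambda>s. LINT x|lborel. \<psi> s x * \<phi> x) has_vector_derivative D) (at t) \<and>
          \<i> * of_real \<epsilon> * D =
            (LINT x|lborel. \<psi> t x * (- of_real (\<epsilon>\<^sup>2 / 2) * laplacian \<phi> x + of_real (V x) * \<phi> x))))"

definition wigner ::
  "real \<Rightarrow> ((real^'d) \<Rightarrow> complex) \<Rightarrow> real^'d \<Rightarrow> real^'d \<Rightarrow> complex"
where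
  "wigner \<epsilon> \<psi> x \<xi> =
     of_real (1 / (2 * pi * \<epsilon>) ^ CARD('d)) *
     (LINT y|lborel. exp (\<i> / of_real \<epsilon> * of_real (y \<bullet> \<xi>)) *
        \<psi> (x - (1/2) *\<^sub>R y) * cnj (\<psi> (x + (1/2) *\<^sub>R y)))"

definition wigner_pairing ::
  "real \<Rightarrow> ((real^'d) \<Rightarrow> complex) \<Rightarrow> ((real^'d) \<times> (real^'d) \<Rightarrow> complex) \<Rightarrow> complex"
where
  "wigner_pairing \<epsilon> \<psi> a = (LINT z|lborel. wigner \<epsilon> \<psi> (fst z) (snd z) * a z)"

text \<open>
  Positive measures are Borel measures that are finite on compact sets; on the closed subsets of
  Euclidean spaces used here these are the positive Radon measures.
\<close>

definition positive_measure_on :: "'a::euclidean_space set \<Rightarrow> 'a measure \<Rightarrow> bool" where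
  "positive_measure_on S M \<longleftrightarrow>
     space M = S \<and> sets M = sets (restrict_space borel S) \<and>
     (\<forall>K. compact K \<and> K \<subseteq> S \<longrightarrow> emeasure M K < \<infinity>)"

text \<open>The coordinates of the ambient space \<open>real \<times> (real^'d) \<times> (real^'d)\<close> are \<open>(t, x, \<xi>)\<close>.\<close>

definition wigner_measure ::
  "(real \<Rightarrow> real \<Rightarrow> real^'d \<Rightarrow> complex) \<Rightarrow> (real \<times> (real^'d) \<times> (real^'d)) measure \<Rightarrow> bool"
where
  "wigner_measure \<Psi> \<mu> \<longleftrightarrow>
     positive_measure_on UNIV \<mu> \<and>
     (\<exists>e :: nat \<Rightarrow> real. (\<forall>k. 0 < e k \<and> e k \<le> 1) \<and> e \<longlonglongrightarrow> 0 \<and>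
        (\<forall>(a :: (real^'d) \<times> (real^'d) \<Rightarrow> complex) (\<Xi> :: real \<Rightarrow> complex).
           test_function a \<and> test_function \<Xi> \<longrightarrow>
           (\<lambda>k. LINT t|lborel. \<Xi> t * wigner_pairing (e k) (\<Psi> (e k) t) a)
             \<longlonglongrightarrow> (LINT z|\<mu>. \<Xi> (fst z) * a (snd z))))"


subsection \<open>Geometry of the singular set\<close>

definition sing_set :: "((real^'d) \<Rightarrow> real^'p) \<Rightarrow> (real^'d) set" where
  "sing_set g = {x. g x = 0}"

definition cotangent_space :: "((real^'d) \<Rightarrow> real^'p) \<Rightarrow> real^'d \<Rightarrow> (real^'d) set" where
  "cotangent_space g \<sigma> = {\<zeta>. jacobian g (at \<sigma>) *v \<zeta> = 0}"

definition cotangent_bundle :: "((real^'d) \<Rightarrow> real^'p) \<Rightarrow> ((real^'d) \<times> (real^'d)) set" where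
  "cotangent_bundle g = {(x, \<xi>). x \<in> sing_set g \<and> \<xi> \<in> cotangent_space g x}"

definition normal_space :: "((real^'d) \<Rightarrow> real^'p) \<Rightarrow> real^'d \<Rightarrow> (real^'d) set" where
  "normal_space g \<sigma> = (cotangent_space g \<sigma>)\<^sup>\<bottom>"

definition orth_proj :: "'a::euclidean_space set \<Rightarrow> 'a \<Rightarrow> 'a" where
  "orth_proj S x = (THE y. y \<in> S \<and> x - y \<in> S\<^sup>\<bottom>)"

lemma orth_proj:
  fixes x :: "'a::euclidean_space"
  assumes "subspace S"
  shows "orth_proj S x \<in> S" "x - orth_proj S x \<in> S\<^sup>\<bottom>"
proof -
  obtain y z where "y \<in> span S" and z: "\<And>w. w \<in> span S \<Longrightarrow> orthogonal z w" and "x = y + z"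
    using orthogonal_subspace_decomp_exists by metis
  moreover have "span S = S"
    using assms by (simp add: span_eq_iff)
  ultimately have y: "y \<in> S" "x - y \<in> S\<^sup>\<bottom>"
    by (auto simp: orthogonal_comp_def orthogonal_commute)
  have "y' = y" if "y' \<in> S" "x - y' \<in> S\<^sup>\<bottom>" for y'
  proof -
    have "y - y' \<in> S"
      using assms y(1) that(1) by (rule subspace_diff)
    moreover have "(x - y') - (x - y) \<in> S\<^sup>\<bottom>"
      using subspace_orthogonal_comp that(2) y(2) by (rule subspace_diff)
    ultimately have "orthogonal (y - y') (y - y')"
      unfolding orthogonal_comp_def by simp
    then show ?thesis
      by (simp add: orthogonal_self)
  qed
  then have "orth_proj S x = y"
    unfolding orth_proj_def using y by (intro the_equality) blast+
  then show "orth_proj S x \<in> S" "x - orth_proj S x \<in> S\<^sup>\<bottom>"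
    using y by simp_all
qed

definition normal_grad ::
  "((real^'d) \<Rightarrow> real^'p) \<Rightarrow> ((real^'d) \<Rightarrow> real) \<Rightarrow> real^'d \<Rightarrow> real^'d"
where
  "normal_grad g f \<sigma> = orth_proj (normal_space g \<sigma>) (grad f \<sigma>)"

definition conical_force ::
  "((real^'d) \<Rightarrow> real^'p) \<Rightarrow> ((real^'d) \<Rightarrow> real) \<Rightarrow> real^'d \<Rightarrow> real^'p \<Rightarrow> real^'d"
where
  "conical_force g F \<sigma> \<omega> = F \<sigma> *\<^sub>R (transpose (jacobian g (at \<sigma>)) *v \<omega>)"

text \<open>
  The bundle \<open>ES\<Gamma>\<close> over a relatively open subset \<open>\<Gamma>\<close> of the singular set, with points
  \<open>(\<sigma>, \<zeta>, \<omega>)\<close>.  The Jacobian at \<open>\<sigma>\<close> maps the normal space isomorphically onto \<open>real^'p\<close>, so the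
  class of a nonzero normal vector \<open>\<rho>\<close> modulo positive dilations is represented by the unit vector
  \<open>\<omega>\<close> which is the normalised image of \<open>\<rho>\<close> under the Jacobian.
\<close>

definition ES :: "((real^'d) \<Rightarrow> real^'p) \<Rightarrow> (real^'d) set \<Rightarrow> ((real^'d) \<times> (real^'d) \<times> (real^'p)) set"
where
  "ES g \<Gamma> = {(\<sigma>, \<zeta>, \<omega>). \<sigma> \<in> \<Gamma> \<and> \<zeta> \<in> cotangent_space g \<sigma> \<and> norm \<omega> = 1}"


subsection \<open>The measure describing the concentration on the cotangent bundle\<close>

text \<open>
  In the first condition below, the embedding of the cotangent bundle as the set where the two
  normal coordinates \<open>\<rho>\<close>, \<open>\<eta>\<close> vanish is \<open>(\<sigma>, \<zeta>) \<mapsto> (x, \<xi>) = (\<sigma>, \<zeta>)\<close>; hence the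
  tensor product of the Dirac masses at \<open>\<rho> = 0\<close>, \<open>\<eta> = 0\<close> with the \<open>\<omega>\<close>-marginal of \<open>\<nu>\<close> is the
  push-forward of \<open>\<nu>\<close> under \<open>(t, \<sigma>, \<zeta>, \<omega>) \<mapsto> (t, \<sigma>, \<zeta>)\<close>.
  In the second condition, the test functions on the closed submanifold
  \<open>\<real> \<times> T\<^sup>*\<Lambda>\<close> are the restrictions of the test functions of the ambient space.
\<close>

definition concentration_measure ::
  "((real^'d) \<Rightarrow> real) \<Rightarrow> ((real^'d) \<Rightarrow> real) \<Rightarrow> ((real^'d) \<Rightarrow> real^'p)
   \<Rightarrow> (real \<times> (real^'d) \<times> (real^'d)) measure
   \<Rightarrow> (real \<times> (real^'d) \<times> (real^'d) \<times> (real^'p)) measure \<Rightarrow> bool"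
where
  "concentration_measure VS F g \<mu> \<nu> \<longleftrightarrow>
     positive_measure_on (UNIV \<times> ES g (sing_set g)) \<nu> \<and>
     density \<mu> (indicator (UNIV \<times> cotangent_bundle g)) =
       distr \<nu> borel (\<lambda>(t, \<sigma>, \<zeta>, \<omega>). (t, \<sigma>, \<zeta>)) \<and>
     (\<forall>\<phi> :: real \<times> (real^'d) \<times> (real^'d) \<Rightarrow> real. test_function \<phi> \<longrightarrow>
        (LINT (t, \<sigma>, \<zeta>, \<omega>)|\<nu>.
           \<phi> (t, \<sigma>, \<zeta>) *\<^sub>R (normal_grad g VS \<sigma> + conical_force g F \<sigma> \<omega>)) = 0)"

end

theory Submission
  imports Defs
begin

text \<open>
  Write \<open>n\<close> for the normal gradient of \<open>VS\<close> at \<open>\<sigma>\<close>.  The strict inequality makes the scalar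
  product of \<open>n\<close> with the total normal force positive at \<open>\<sigma>\<close> for all unit \<open>\<omega>\<close>, and
  by continuity also at all points near \<open>\<sigma>\<close>.  Testing the asymmetry condition against
  nonnegative functions supported near \<open>\<sigma>\<close> and pairing it with \<open>n\<close> gives a vanishing integral of a
  nonnegative function, so \<open>\<nu>\<close> does not charge the set where the test functions are positive.
\<close>

subsection \<open>Smooth functions\<close>

lemma Ck_const: "Ck k (\<lambda>x. c)"
  by (induction k arbitrary: c) (auto simp: frechet_derivative_const)

lemma Ck_affine:
  assumes "bounded_linear f"
  shows "Ck k (\<lambda>x. f x + c)"
proof (cases k)
  case 0
  then show ?thesis
    using assms by (simp add: continuous_on_add continuous_on_const linear_continuous_on)
next
  case (Suc m)
  have D: "((\<lambda>x. f x + c) has_derivative f) (at x)" for x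
    using has_derivative_add_const bounded_linear_imp_has_derivative[OF assms] by blast
  then have "frechet_derivative (\<lambda>x. f x + c) (at x) = f" for x
    using frechet_derivative_at by metis
  with D Suc show ?thesis
    by (auto simp: differentiable_def Ck_const)
qed

text \<open>\<open>Ck (Suc k)\<close> mentions only differentiability and the directional
  derivatives, so lower orders are recovered by induction; at the base, differentiable maps are
  continuous.\<close>

lemma Ck_Suc_D: "Ck (Suc k) f \<Longrightarrow> Ck k f"
proof (induction k arbitrary: f)
  case 0
  then show ?case
    by (auto simp: continuous_on_eq_continuous_at intro: differentiable_imp_continuous_within)
next
  case (Suc k)
  then show ?case
    using Ck.simps(2) by blast
qed

lemma Ck_add:
  assumes "Ck k f" "Ck k g"
  shows "Ck k (\<lambda>x. f x + g x)"
  using assms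
proof (induction k arbitrary: f g)
  case 0
  then show ?case by (auto intro: continuous_intros)
next
  case (Suc k)
  then have "frechet_derivative (\<lambda>x. f x + g x) (at x)
      = (\<lambda>v. frechet_derivative f (at x) v + frechet_derivative g (at x) v)" for x
    by (intro frechet_derivative_at[symmetric] has_derivative_add)
      (auto simp: frechet_derivative_works)
  with Suc show ?case by auto
qed

lemma Ck_mult:
  fixes f g :: "'a::euclidean_space \<Rightarrow> real"
  assumes "Ck k f" "Ck k g"
  shows "Ck k (\<lambda>x. f x * g x)"
  using assms
proof (induction k arbitrary: f g)
  case 0
  then show ?case by (auto intro: continuous_intros)
next
  case (Suc k)
  then have "frechet_derivative (\<lambda>x. f x * g x) (at x)
      = (\<lambda>v. f x * frechet_derivative g (at x) v + frechet_derivative f (at x) v * g x)" for x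
    by (intro frechet_derivative_at[symmetric] has_derivative_mult)
      (auto simp: frechet_derivative_works)
  \<comment> \<open>The Leibniz terms contain \<open>f\<close> and \<open>g\<close>
    undifferentiated, and the induction hypothesis needs these at order \<open>k\<close>.\<close>
  moreover have "Ck k f" "Ck k g"
    using Suc.prems Ck_Suc_D by blast+
  ultimately show ?case
    using Suc by (auto intro!: Ck_add Suc.IH)
qed

lemma continuous_on_frechet_derivative_smooth:
  assumes "smooth f"
  shows "continuous_on UNIV (\<lambda>x. frechet_derivative f (at x) v)"
  using assms unfolding smooth_def by (metis Ck.simps)

lemma continuous_on_smooth: "smooth f \<Longrightarrow> continuous_on UNIV f"
  unfolding smooth_def by (metis Ck.simps(1))


subsection \<open>Bump functions\<close>

text \<open>The polynomial parameter makes the family closed under differentiation;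
  \<open>P = 1\<close> is the classical flat function exp(-1/u).\<close>

definition flat_exp :: "real poly \<Rightarrow> real \<Rightarrow> real" where
  "flat_exp P u = (if u > 0 then poly P (1 / u) * exp (- (1 / u)) else 0)"

text \<open>Substituting y = 1/u turns this into the decay of P(y) exp(-y) at infinity.\<close>

lemma flat_exp_poly_tendsto: "((\<lambda>u. poly P (1 / u) * exp (- (1 / u))) \<longlongrightarrow> 0) (at_right (0::real))"
proof -
  have "((\<lambda>y. poly P y * exp (- y)) \<longlongrightarrow> 0) at_top"
  proof -
    have "((\<lambda>y. \<Sum>i\<le>degree P. coeff P i * (y ^ i / exp y)) \<longlongrightarrow> (\<Sum>i\<le>degree P. coeff P i * 0)) at_top"
      by (intro tendsto_intros tendsto_power_div_exp_0)
    then show ?thesis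
      by (simp add: poly_altdef sum_distrib_right exp_minus divide_inverse mult.assoc)
  qed
  moreover have "filterlim (\<lambda>u::real. 1 / u) at_top (at_right 0)"
    using filterlim_inverse_at_top_right by (simp add: inverse_eq_divide)
  ultimately show ?thesis
    by (rule filterlim_compose)
qed

text \<open>For u > 0 the chain rule gives (P - P')(1/u) exp(-1/u) / u^2, and
  \<open>monom 1 2\<close> encodes the factor 1/u^2. Only u = 0 needs a limit.\<close>

lemma flat_exp_has_derivative:
  "(flat_exp P has_field_derivative flat_exp (monom 1 2 * (P - pderiv P)) u) (at u)"
proof -
  consider "u > 0" | "u < 0" | "u = 0" by linarith
  then show ?thesis
  proof cases
    case 1
    have "((\<lambda>u. poly P (1 / u) * exp (- (1 / u))) has_field_derivative
        flat_exp (monom 1 2 * (P - pderiv P)) u) (at u)"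
      using 1
      by (auto intro!: derivative_eq_intros DERIV_chain2[OF poly_DERIV]
          simp: flat_exp_def poly_monom field_simps power2_eq_square)
    then show ?thesis
      by (rule has_field_derivative_transform_within_open[where S = "{0<..}"])
        (use 1 in \<open>auto simp: flat_exp_def\<close>)
  next
    case 2
    have "((\<lambda>u. 0) has_field_derivative flat_exp (monom 1 2 * (P - pderiv P)) u) (at u)"
      using 2 by (simp add: flat_exp_def)
    then show ?thesis
      by (rule has_field_derivative_transform_within_open[where S = "{..<0}"])
        (use 2 in \<open>auto simp: flat_exp_def\<close>)
  next
    case 3
    \<comment> \<open>Dividing by y multiplies the polynomial by its variable, so the right-hand
      difference quotient is again of the form that tends to 0.\<close>
    have "((\<lambda>y. flat_exp P y / y) \<longlongrightarrow> 0) (at_right 0)"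
      by (rule Lim_transform_eventually[OF flat_exp_poly_tendsto[of "monom 1 1 * P"]])
        (auto simp: eventually_at_filter flat_exp_def poly_monom)
    moreover have "((\<lambda>y. flat_exp P y / y) \<longlongrightarrow> 0) (at_left 0)"
      by (rule tendsto_eventually) (auto simp: eventually_at_filter flat_exp_def)
    ultimately have "((\<lambda>y. flat_exp P y / y) \<longlongrightarrow> 0) (at 0)"
      by (simp add: filterlim_split_at)
    then show ?thesis
      using 3 by (simp add: has_field_derivative_iff flat_exp_def)
  qed
qed

text \<open>Differentiating only changes the polynomial and adds a factor from the derivative of
  \<open>q\<close>; hence the induction runs over all \<open>P\<close> at once.\<close>

lemma Ck_flat_exp_comp:
  fixes q :: "'a::euclidean_space \<Rightarrow> real"
  assumes "smooth q"
  shows "Ck k (\<lambda>x. flat_exp P (q x))"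
proof (induction k arbitrary: P)
  case 0
  have "continuous_on UNIV (flat_exp P)"
    using DERIV_isCont[OF flat_exp_has_derivative] by (simp add: continuous_on_eq_continuous_at)
  then show ?case
    using continuous_on_smooth[OF assms] by (auto intro: continuous_on_compose2)
next
  case (Suc k)
  have q: "q differentiable (at x)" for x
    using assms unfolding smooth_def by (metis Ck.simps(2))
  have D: "((\<lambda>x. flat_exp P (q x)) has_derivative
      (\<lambda>v. flat_exp (monom 1 2 * (P - pderiv P)) (q x) * frechet_derivative q (at x) v)) (at x)" for x
    by (rule DERIV_compose_FDERIV[OF flat_exp_has_derivative, THEN has_derivative_eq_rhs])
      (use q in \<open>auto simp: frechet_derivative_works[symmetric] mult.commute\<close>)
  have "Ck k (\<lambda>x. frechet_derivative q (at x) v)" for v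
    using assms unfolding smooth_def by (metis Ck.simps(2))
  then have "Ck k (\<lambda>x. flat_exp (monom 1 2 * (P - pderiv P)) (q x) * frechet_derivative q (at x) v)" for v
    by (intro Ck_mult Suc)
  then show ?case
    using D frechet_derivative_at[OF D, symmetric] by (auto simp: differentiable_def)
qed

lemma smooth_quadratic:
  fixes L :: "'a::euclidean_space \<Rightarrow> 'b::real_inner"
  assumes "bounded_linear L"
  shows "smooth (\<lambda>z. r - L (z - c) \<bullet> L (z - c))"
  unfolding smooth_def
proof
  fix k
  interpret L: bounded_linear L by fact
  have D: "((\<lambda>z. r - L (z - c) \<bullet> L (z - c)) has_derivative (\<lambda>v. - 2 * (L (z - c) \<bullet> L v))) (at z)" for z
    by (auto intro!: derivative_eq_intros L.has_derivative simp: inner_commute)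
  have aff: "Ck k (\<lambda>z. - 2 * (L (z - c) \<bullet> L v))" for k v
  proof -
    have "Ck k (\<lambda>z. (- 2 * (L z \<bullet> L v)) + 2 * (L c \<bullet> L v))"
      by (intro Ck_affine bounded_linear_const_mult bounded_linear_inner_left_comp assms)
    then show ?thesis
      by (simp add: L.diff inner_diff_left algebra_simps)
  qed
  \<comment> \<open>Working one order higher treats \<open>k = 0\<close> uniformly: the directional
    derivatives are affine in \<open>z\<close>, hence of every order.\<close>
  have "Ck (Suc k) (\<lambda>z. r - L (z - c) \<bullet> L (z - c))"
    using D frechet_derivative_at[OF D, symmetric] aff[of k]
    by (auto simp: differentiable_def)
  then show "Ck k (\<lambda>z. r - L (z - c) \<bullet> L (z - c))"
    by (rule Ck_Suc_D)
qed

text \<open>The flat exponential is composed with r^2 - |L(z - c)|^2, which for r > 0 is positive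
  exactly on the ellipsoid. Injectivity bounds \<open>L\<close> from below, so the ellipsoid is
  bounded and the support compact.\<close>

lemma ellipsoid_bump_exists:
  fixes L :: "'a::euclidean_space \<Rightarrow> 'b::euclidean_space"
  assumes "linear L" "inj L"
  obtains \<phi> :: "'a \<Rightarrow> real"
  where "test_function \<phi>" "\<And>z. 0 \<le> \<phi> z" "\<And>z. 0 < \<phi> z \<longleftrightarrow> norm (L (z - c)) < r"
proof (cases "r > 0")
  \<comment> \<open>The ellipsoid is empty, so the zero function serves.\<close>
  case False
  have "test_function (\<lambda>z::'a. 0::real)"
    by (simp add: test_function_def smooth_def Ck_const)
  then show thesis
    by (rule that) (use False norm_ge_zero order.trans in \<open>force simp: not_less\<close>)+
next
  case True
  define q where "q z = r\<^sup>2 - L (z - c) \<bullet> L (z - c)" for z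
  have L: "bounded_linear L"
    using assms(1) by (rule linear_conv_bounded_linear[THEN iffD1])
  obtain B where B: "B > 0" "\<And>x. B * norm x \<le> norm (L x)"
    using linear_inj_bounded_below_pos[OF assms] by blast
  have q: "0 < q z \<longleftrightarrow> norm (L (z - c)) < r" for z
    using True power2_less_imp_less[of "norm (L (z - c))" r] power_strict_mono[of "norm (L (z - c))" r 2]
    by (auto simp: q_def power2_norm_eq_inner[symmetric])
  have pos: "0 < flat_exp 1 (q z) \<longleftrightarrow> norm (L (z - c)) < r" for z
    by (simp add: flat_exp_def flip: q)
  have "{z. flat_exp 1 (q z) \<noteq> 0} \<subseteq> cball c (r / B)"
  proof
    fix z assume "z \<in> {z. flat_exp 1 (q z) \<noteq> 0}"
    then have "norm (L (z - c)) < r"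
      using q by (auto simp: flat_exp_def split: if_splits)
    then have "B * norm (z - c) \<le> r"
      using B(2)[of "z - c"] by linarith
    then show "z \<in> cball c (r / B)"
      using B(1) by (simp add: dist_norm norm_minus_commute field_simps)
  qed
  then have "compact (closure {z. flat_exp 1 (q z) \<noteq> 0})"
    by (meson bounded_cball bounded_subset compact_closure)
  moreover have "smooth (\<lambda>z. flat_exp 1 (q z))"
    using Ck_flat_exp_comp[OF smooth_quadratic[OF L]] unfolding smooth_def q_def by blast
  ultimately show thesis
    using pos by (intro that[of "\<lambda>z. flat_exp 1 (q z)"]) (auto simp: test_function_def flat_exp_def)
qed


subsection \<open>Continuity of the normal gradient\<close>

lemma orth_proj_unique:
  assumes "subspace S" "y \<in> S" "x - y \<in> S\<^sup>\<bottom>"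
  shows "orth_proj S x = y"
proof -
  have "y - orth_proj S x \<in> S"
    using assms orth_proj(1) subspace_diff by blast
  moreover have "(x - orth_proj S x) - (x - y) \<in> S\<^sup>\<bottom>"
    using assms orth_proj(2) subspace_orthogonal_comp subspace_diff by blast
  ultimately have "orthogonal (y - orth_proj S x) (y - orth_proj S x)"
    unfolding orthogonal_comp_def by simp
  then show ?thesis
    by (simp add: orthogonal_self)
qed

text \<open>A kernel vector \<open>w\<close> of the Gram matrix satisfies |J^T w|^2 = 0, and J^T is
  injective because \<open>J\<close> has full row rank.\<close>

lemma det_gram_nonzero:
  fixes J :: "real^'n^'m"
  assumes "rank J = CARD('m)"
  shows "det (J ** transpose J) \<noteq> 0"
proof -
  have "inj ((*v) (transpose J))"
    using assms by (simp add: full_rank_injective[symmetric] rank_transpose)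
  have "w = 0" if "(J ** transpose J) *v w = 0" for w
  proof -
    have "(transpose J *v w) \<bullet> (transpose J *v w) = w \<bullet> ((J ** transpose J) *v w)"
      by (metis dot_lmul_matrix inner_commute matrix_vector_mul_assoc transpose_matrix_vector)
    then have "transpose J *v w = transpose J *v 0"
      using that by simp
    with \<open>inj _\<close> show "w = 0"
      by (rule injD)
  qed
  then show ?thesis
    by (metis invertible_det_nz invertible_left_inverse matrix_left_invertible_ker)
qed

text \<open>The hypothesis is the normal equation: it puts the residual in the kernel of
  \<open>J\<close>, while J^T w is always orthogonal to that kernel.\<close>

lemma orth_proj_orth_ker:
  fixes J :: "real^'n^'m"
  assumes "(J ** transpose J) *v w = J *v v"
  shows "orth_proj ({z. J *v z = 0}\<^sup>\<bottom>) v = transpose J *v w"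
proof (rule orth_proj_unique)
  show "subspace ({z. J *v z = 0}\<^sup>\<bottom>)"
    by (rule subspace_orthogonal_comp)
  have "orthogonal z (transpose J *v w)" if "J *v z = 0" for z
    using that
    by (metis dot_lmul_matrix inner_commute inner_zero_left orthogonal_def transpose_matrix_vector)
  then show "transpose J *v w \<in> {z. J *v z = 0}\<^sup>\<bottom>"
    by (simp add: orthogonal_comp_def)
  have "J *v (v - transpose J *v w) = 0"
    using assms by (simp add: matrix_vector_mult_diff_distrib matrix_vector_mul_assoc
        del: transpose_matrix_vector)
  then show "v - transpose J *v w \<in> {z. J *v z = 0}\<^sup>\<bottom>\<^sup>\<bottom>"
    by (auto simp: orthogonal_comp_def orthogonal_commute)
qed

lemma continuous_on_det:
  fixes A :: "'a::topological_space \<Rightarrow> real^'n^'n"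
  assumes "continuous_on S A"
  shows "continuous_on S (\<lambda>x. det (A x))"
  unfolding det_def using assms by (intro continuous_intros)

lemma continuous_on_grad:
  assumes "smooth f"
  shows "continuous_on UNIV (grad f)"
  unfolding grad_def[abs_def]
  by (intro continuous_intros continuous_on_frechet_derivative_smooth assms)

lemma continuous_on_jacobian:
  fixes g :: "real^'n \<Rightarrow> real^'m"
  assumes "smooth g"
  shows "continuous_on UNIV (\<lambda>x. jacobian g (at x))"
  unfolding jacobian_def matrix_def
  by (intro continuous_intros continuous_on_frechet_derivative_smooth assms)

lemma continuous_on_matrix_vector_mult:
  fixes A :: "'a::topological_space \<Rightarrow> real^'n^'m"
  assumes "continuous_on S A" "continuous_on S v"
  shows "continuous_on S (\<lambda>x. A x *v v x)"
  unfolding matrix_vector_mult_def using assms by (intro continuous_intros)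

lemma continuous_on_transpose:
  fixes A :: "'a::topological_space \<Rightarrow> real^'n^'m"
  assumes "continuous_on S A"
  shows "continuous_on S (\<lambda>x. transpose (A x))"
  unfolding transpose_def using assms by (intro continuous_intros)

text \<open>The projection has the closed form J^T (J J^T)^{-1} J grad f, whose ingredients all
  depend continuously on the point.\<close>

lemma continuous_on_normal_grad:
  fixes g :: "real^'n \<Rightarrow> real^'m"
  assumes "smooth f" "smooth g" and rank: "\<And>x. rank (jacobian g (at x)) = CARD('m)"
  shows "continuous_on UNIV (normal_grad g f)"
proof -
  define J where "J x = jacobian g (at x)" for x
  define G where "G x = J x ** transpose (J x)" for x
  define b where "b x = J x *v grad f x" for x
  \<comment> \<open>Cramer's rule solves the normal equation by quotients of determinants, so
    continuity needs no separate study of matrix inversion.\<close>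
  define w where "w x = (\<chi> k. det (\<chi> i j. if j = k then b x $ i else G x $ i $ j) / det (G x))" for x
  have det: "det (G x) \<noteq> 0" for x
    unfolding G_def J_def using rank by (rule det_gram_nonzero)
  have "G x *v w x = b x" for x
    using cramer[OF det] unfolding w_def by blast
  then have eq: "normal_grad g f x = transpose (J x) *v w x" for x
    unfolding normal_grad_def normal_space_def cotangent_space_def b_def G_def J_def[symmetric]
    by (rule orth_proj_orth_ker)
  have J: "continuous_on UNIV J"
    unfolding J_def using assms(2) by (rule continuous_on_jacobian)
  then have b: "continuous_on UNIV b"
    unfolding b_def using assms(1)
    by (intro continuous_on_matrix_vector_mult continuous_on_grad)
  have G: "continuous_on UNIV G"
    unfolding G_def matrix_matrix_mult_def using J
    by (intro continuous_intros continuous_on_transpose)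
  have "continuous_on UNIV (\<lambda>x. if j = k then b x $ i else G x $ i $ j)" for i j k
    using b G by (cases "j = k") (auto intro!: continuous_intros)
  then have "continuous_on UNIV w"
    unfolding w_def using det G by (intro continuous_intros continuous_on_det) auto
  with J show ?thesis
    unfolding eq[abs_def] by (intro continuous_on_matrix_vector_mult continuous_on_transpose)
qed

section \<open>Estimates for the conical force\<close>

lemma inner_conical_force:
  "n \<bullet> conical_force g F s \<omega> = F s * ((jacobian g (at s) *v n) \<bullet> \<omega>)"
  unfolding conical_force_def
  by (simp add: dot_lmul_matrix inner_commute[of n] inner_commute[of _ \<omega>])

lemma linear_conical_force: "linear (conical_force g F s)"
  unfolding conical_force_def
  by (intro linearI) (auto simp: matrix_vector_right_distrib algebra_simps)

text \<open>The left side is the norm of the adjoint of \<open>conical_force g F s\<close> applied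
  to \<open>n\<close>. The adjoint bound follows by testing the force on that very vector
  \<omega>.\<close>

lemma norm_scaled_jacobian_le:
  "\<bar>F s\<bar> * norm (jacobian g (at s) *v n) \<le> onorm (conical_force g F s) * norm n"
proof -
  define \<omega> where "\<omega> = F s *\<^sub>R (jacobian g (at s) *v n)"
  have "norm \<omega> * norm \<omega> = n \<bullet> conical_force g F s \<omega>"
    by (simp add: inner_conical_force \<omega>_def power2_eq_square power2_norm_eq_inner[symmetric])
  also have "\<dots> \<le> norm n * norm (conical_force g F s \<omega>)"
    by (rule norm_cauchy_schwarz)
  also have "\<dots> \<le> norm n * (onorm (conical_force g F s) * norm \<omega>)"
    by (intro mult_left_mono onorm linear_conv_bounded_linear[THEN iffD1] linear_conical_force) auto
  finally have "norm \<omega> * norm \<omega> \<le> (onorm (conical_force g F s) * norm n) * norm \<omega>"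
    by (simp add: mult_ac)
  \<comment> \<open>A factor \<open>norm \<omega>\<close> cancels; if \<omega> vanishes,
    nonnegativity of the operator norm suffices.\<close>
  then have "norm \<omega> \<le> onorm (conical_force g F s) * norm n"
    using onorm_pos_le[OF linear_conv_bounded_linear[THEN iffD1], OF linear_conical_force[of g F s]]
    by (cases "\<omega> = 0") (auto dest: mult_right_le_imp_le)
  then show ?thesis
    by (simp add: \<omega>_def)
qed


subsection \<open>Vanishing of the measure\<close>

text \<open>Closedness makes traces of compact sets on the bundle compact, and on these \<nu> is
  known to be finite.\<close>

lemma closed_ES_sing_set:
  assumes "smooth g"
  shows "closed (UNIV \<times> ES g (sing_set g))"
proof -
  have "ES g (sing_set g) = {z. g (fst z) = 0} \<inter> {z. jacobian g (at (fst z)) *v fst (snd z) = 0}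
      \<inter> {z. norm (snd (snd z)) = 1}"
    by (auto simp: ES_def sing_set_def cotangent_space_def)
  moreover have "continuous_on UNIV (\<lambda>z::(real^'a) \<times> (real^'a) \<times> (real^'b). g (fst z))"
    by (rule continuous_on_compose2[OF continuous_on_smooth[OF assms]]) (auto intro: continuous_intros)
  moreover have "continuous_on UNIV (\<lambda>z::(real^'a) \<times> (real^'a) \<times> (real^'b). jacobian g (at (fst z)))"
    by (rule continuous_on_compose2[OF continuous_on_jacobian[OF assms]]) (auto intro: continuous_intros)
  ultimately have "closed (ES g (sing_set g))"
    by (auto intro!: closed_Int closed_Collect_eq continuous_intros continuous_on_matrix_vector_mult)
  then show ?thesis
    by (simp add: closed_Times)
qed

lemma integrable_positive_measure_on:
  fixes f :: "'a::euclidean_space \<Rightarrow> 'b::euclidean_space"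
  assumes M: "positive_measure_on S M" and "closed S"
    and f: "continuous_on UNIV f" and "compact C" and "\<And>z. z \<in> S \<Longrightarrow> z \<notin> C \<Longrightarrow> f z = 0"
  shows "integrable M f"
proof -
  have space: "space M = S" and sets: "sets M = sets (restrict_space borel S)"
    and fin: "\<And>K. compact K \<Longrightarrow> K \<subseteq> S \<Longrightarrow> emeasure M K < \<infinity>"
    using M unfolding positive_measure_on_def by auto
  have K: "compact (C \<inter> S)"
    using assms by (simp add: compact_Int_closed)
  then have "bounded (f ` (C \<inter> S))"
    using f by (meson compact_continuous_image compact_imp_bounded continuous_on_subset top_greatest)
  then obtain B where B: "\<And>z. z \<in> C \<inter> S \<Longrightarrow> norm (f z) \<le> B"
    unfolding bounded_iff by blast
  show ?thesis
  proof (rule integrableI_bounded_set[where A = "C \<inter> S" and B = B])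
    show "C \<inter> S \<in> sets M"
      unfolding sets sets_restrict_space using assms(4) by (auto simp: borel_compact)
    show "f \<in> borel_measurable M"
      using f measurable_cong_sets[OF sets refl]
      by (metis borel_measurable_continuous_onI measurable_restrict_space1)
    show "emeasure M (C \<inter> S) < \<infinity>"
      using K by (rule fin) auto
  qed (use B assms(5) space in auto)
qed

lemma AE_test_function_eq_0:
  fixes F VS :: "real^'d \<Rightarrow> real" and g :: "real^'d \<Rightarrow> real^'p"
    and \<nu> :: "(real \<times> (real^'d) \<times> (real^'d) \<times> (real^'p)) measure"
    and \<phi> :: "real \<times> (real^'d) \<times> (real^'d) \<Rightarrow> real"
  assumes pot: "conical_potential V VS F g"
    and conc: "concentration_measure VS F g \<mu> \<nu>"
    and \<phi>: "test_function \<phi>" "\<And>z. 0 \<le> \<phi> z"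
    and pos: "\<And>t s \<zeta> \<omega>. 0 < \<phi> (t, s, \<zeta>) \<Longrightarrow> norm \<omega> = 1 \<Longrightarrow>
      0 < n \<bullet> (normal_grad g VS s + conical_force g F s \<omega>)"
  shows "AE (t, s, \<zeta>, \<omega>) in \<nu>. \<phi> (t, s, \<zeta>) = 0"
proof -
  have smooth: "smooth F" "smooth VS" "smooth g"
    and rank: "\<And>x. rank (jacobian g (at x)) = CARD('p)"
    using pot unfolding conical_potential_def by auto
  define S where "S = (UNIV :: real set) \<times> ES g (sing_set g)"
  have M: "positive_measure_on S \<nu>"
    using conc unfolding concentration_measure_def S_def by blast
  define f where "f = (\<lambda>(t, s, \<zeta>, \<omega>). \<phi> (t, s, \<zeta>) *\<^sub>R (normal_grad g VS s + conical_force g F s \<omega>))"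
  have int0: "(LINT z|\<nu>. f z) = 0"
    using conc \<phi>(1) unfolding concentration_measure_def f_def by blast
  define T where "T = closure {z. \<phi> z \<noteq> 0}"
  \<comment> \<open>The fibre variable \<omega> ranges over a compact sphere, so no cutoff in
    \<omega> is needed.\<close>
  define C where "C = (\<lambda>((t, s, \<zeta>), \<omega>). (t, s, \<zeta>, \<omega>)) ` (T \<times> sphere (0::real^'p) 1)"
  have "compact C"
    using \<phi>(1) unfolding C_def test_function_def T_def
    by (intro compact_continuous_image compact_Times compact_sphere)
      (auto simp: case_prod_unfold intro!: continuous_intros)
  have out: "f z = 0" if z: "z \<in> S" "z \<notin> C" for z
  proof -
    obtain t s \<zeta> \<omega> where [simp]: "z = (t, s, \<zeta>, \<omega>)"
      by (metis prod.exhaust)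
    have "norm \<omega> = 1"
      using z(1) by (auto simp: S_def ES_def)
    then have "(t, s, \<zeta>) \<notin> T"
      using z(2) by (force simp: C_def)
    then have "\<phi> (t, s, \<zeta>) = 0"
      using closure_subset[of "{z. \<phi> z \<noteq> 0}"] by (auto simp: T_def)
    then show ?thesis by (simp add: f_def)
  qed
  have "continuous_on UNIV f"
    unfolding f_def case_prod_unfold conical_force_def
    by (intro continuous_intros continuous_on_matrix_vector_mult continuous_on_transpose
        continuous_on_compose2[OF continuous_on_normal_grad[OF smooth(2,3) rank]]
        continuous_on_compose2[OF continuous_on_jacobian[OF smooth(3)]]
        continuous_on_compose2[OF continuous_on_smooth[OF smooth(1)]]
        continuous_on_compose2[OF continuous_on_smooth[of \<phi>]])
      (use \<phi>(1) in \<open>auto simp: test_function_def\<close>)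
  \<comment> \<open>Integrability gives \<open>int0\<close> its content: the Bochner integral of a
    non-integrable function is 0 by convention.\<close>
  then have int: "integrable \<nu> f"
    using \<open>compact C\<close> out closed_ES_sing_set[OF smooth(3)] M unfolding S_def
    by (intro integrable_positive_measure_on) auto
  have sp: "norm \<omega> = 1" if "(t, s, \<zeta>, \<omega>) \<in> space \<nu>" for t s \<zeta> \<omega>
    using that M by (auto simp: positive_measure_on_def S_def ES_def)
  have nonneg: "AE z in \<nu>. 0 \<le> n \<bullet> f z"
  proof (rule AE_I2)
    fix z assume "z \<in> space \<nu>"
    moreover obtain t s \<zeta> \<omega> where "z = (t, s, \<zeta>, \<omega>)"
      by (metis prod.exhaust)
    ultimately show "0 \<le> n \<bullet> f z"
      using pos[of t s \<zeta> \<omega>] \<phi>(2)[of "(t, s, \<zeta>)"] sp[of t s \<zeta> \<omega>]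
      by (cases "\<phi> (t, s, \<zeta>) = 0") (auto simp: f_def)
  qed
  have "(LINT z|\<nu>. n \<bullet> f z) = 0"
    using int int0 by simp
  then have "AE z in \<nu>. n \<bullet> f z = 0"
    using integral_nonneg_eq_0_iff_AE[OF integrable_inner_right nonneg] int by simp
  then show ?thesis
  proof (rule AE_mp, intro AE_I2 impI)
    fix z assume "z \<in> space \<nu>" "n \<bullet> f z = 0"
    moreover obtain t s \<zeta> \<omega> where "z = (t, s, \<zeta>, \<omega>)"
      by (metis prod.exhaust)
    ultimately show "case z of (t, s, \<zeta>, \<omega>) \<Rightarrow> \<phi> (t, s, \<zeta>) = 0"
      using pos[of t s \<zeta> \<omega>] \<phi>(2)[of "(t, s, \<zeta>)"] sp[of t s \<zeta> \<omega>]
      by (cases "\<phi> (t, s, \<zeta>) = 0") (auto simp: f_def)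
  qed
qed

theorem theorem1p7:
  fixes V VS F :: "real^'d \<Rightarrow> real"
    and g :: "real^'d \<Rightarrow> real^'p"
    and \<Psi> :: "real \<Rightarrow> real \<Rightarrow> real^'d \<Rightarrow> complex"
    and \<mu> :: "(real \<times> (real^'d) \<times> (real^'d)) measure"
    and \<nu> :: "(real \<times> (real^'d) \<times> (real^'d) \<times> (real^'p)) measure"
    and \<sigma> :: "real^'d"
  assumes "conical_potential V VS F g"
    and "\<And>\<epsilon>. 0 < \<epsilon> \<Longrightarrow> \<epsilon> \<le> 1 \<Longrightarrow> schroedinger_solution \<epsilon> V (\<Psi> \<epsilon>)"
    and "\<And>\<epsilon>. 0 < \<epsilon> \<Longrightarrow> \<epsilon> \<le> 1 \<Longrightarrow> (LINT x|lborel. (cmod (\<Psi> \<epsilon> 0 x))\<^sup>2) = 1"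
    and "wigner_measure \<Psi> \<mu>"
    and "concentration_measure VS F g \<mu> \<nu>"
    and "\<sigma> \<in> sing_set g"
    and "onorm (conical_force g F \<sigma>) < norm (normal_grad g VS \<sigma>)"
  shows "\<exists>\<Gamma>. openin (top_of_set (sing_set g)) \<Gamma> \<and> \<sigma> \<in> \<Gamma> \<and> UNIV \<times> ES g \<Gamma> \<in> null_sets \<nu>"
proof -
  have smooth: "smooth F" "smooth VS" "smooth g"
    and rank: "\<And>x. rank (jacobian g (at x)) = CARD('p)"
    using assms(1) unfolding conical_potential_def by auto
  \<comment> \<open>The vector is frozen at \<sigma>: being constant, it can be pulled out of the
    vector-valued integral.\<close>
  define n where "n = normal_grad g VS \<sigma>"
  \<comment> \<open>This is the least value over unit \<omega> of the scalar product of
    \<open>n\<close> with the total normal force at \<open>s\<close>.\<close>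
  define m where "m s = n \<bullet> normal_grad g VS s - \<bar>F s\<bar> * norm (jacobian g (at s) *v n)" for s
  have "continuous_on UNIV m"
    unfolding m_def
    by (intro continuous_intros continuous_on_matrix_vector_mult continuous_on_jacobian
        continuous_on_normal_grad continuous_on_smooth smooth rank)
  then have "open {s. 0 < m s}"
    by (intro open_Collect_less continuous_intros)
  moreover have "0 < m \<sigma>"
  proof -
    \<comment> \<open>Together with the strict hypothesis this forces \<open>n\<close> to be
      nonzero, so multiplying by \<open>norm n\<close> keeps the inequality strict.\<close>
    have "0 \<le> onorm (conical_force g F \<sigma>)"
      by (intro onorm_pos_le linear_conv_bounded_linear[THEN iffD1] linear_conical_force)
    then have "onorm (conical_force g F \<sigma>) * norm n < norm n * norm n"
      using assms(7) by (intro mult_strict_right_mono) (auto simp: n_def)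
    then show ?thesis
      using norm_scaled_jacobian_le[of F \<sigma> g n]
      by (simp add: m_def n_def[symmetric] norm_eq_sqrt_inner)
  qed
  ultimately obtain r where r: "r > 0" "ball \<sigma> r \<subseteq> {s. 0 < m s}"
    by (metis mem_Collect_eq open_contains_ball)
  have pos: "0 < n \<bullet> (normal_grad g VS s + conical_force g F s \<omega>)"
    if "s \<in> ball \<sigma> r" "norm \<omega> = 1" for s \<omega>
  proof -
    have "\<bar>n \<bullet> conical_force g F s \<omega>\<bar> \<le> \<bar>F s\<bar> * norm (jacobian g (at s) *v n)"
      using Cauchy_Schwarz_ineq2[of "jacobian g (at s) *v n" \<omega>] that(2)
      by (simp add: inner_conical_force abs_mult mult_left_mono)
    moreover have "0 < m s"
      using r(2) that(1) by blast
    ultimately show ?thesis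
      by (simp add: m_def inner_add_right)
  qed
  txt \<open>The ellipsoids \<open>norm (L k (t, s - \<sigma>, \<zeta>)) < r\<close> are bounded and exhaust
    \<open>\<real> \<times> ball \<sigma> r \<times> \<real>\<^sup>d\<close> as \<open>k\<close> grows.\<close>
  define L :: "nat \<Rightarrow> real \<times> (real^'d) \<times> (real^'d) \<Rightarrow> real \<times> (real^'d) \<times> (real^'d)"
    where "L k = (\<lambda>(t, s, \<zeta>). (t / Suc k, s, \<zeta> /\<^sub>R Suc k))" for k
  have AE: "AE (t, s, \<zeta>, \<omega>) in \<nu>. r \<le> norm (L k (t, s - \<sigma>, \<zeta>))" for k
  proof -
    have lin: "linear (L k)"
      by (rule linearI) (auto simp: L_def add_divide_distrib scaleR_add_right mult_ac)
    have "inj (L k)"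
      by (auto simp: L_def inj_def)
    then obtain \<phi> where \<phi>: "test_function \<phi>" "\<And>z. (0::real) \<le> \<phi> z"
        "\<And>z. 0 < \<phi> z \<longleftrightarrow> norm (L k (z - (0, \<sigma>, 0))) < r"
      using ellipsoid_bump_exists[OF lin] by blast
    \<comment> \<open>\<open>L k\<close> leaves the position component unscaled, so every ellipsoid
      projects into the ball where \<open>pos\<close> applies.\<close>
    have "s \<in> ball \<sigma> r" if "0 < \<phi> (t, s, \<zeta>)" for t s \<zeta>
    proof -
      have "norm (s - \<sigma>) \<le> norm (snd (L k (t, s - \<sigma>, \<zeta>)))"
        using norm_fst_le[of "s - \<sigma>"] by (simp add: L_def)
      also have "\<dots> \<le> norm (L k (t, s - \<sigma>, \<zeta>))"
        by (metis norm_snd_le prod.collapse)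
      finally show ?thesis
        using that \<phi>(3) by (simp add: dist_norm norm_minus_commute)
    qed
    then have "AE (t, s, \<zeta>, \<omega>) in \<nu>. \<phi> (t, s, \<zeta>) = 0"
      using pos by (intro AE_test_function_eq_0[OF assms(1,5) \<phi>(1,2), where n = n]) blast
    then show ?thesis
      by eventually_elim (use \<phi>(3) in \<open>force simp: not_less[symmetric]\<close>)
  qed
  define \<Gamma> where "\<Gamma> = sing_set g \<inter> ball \<sigma> r"
  have "positive_measure_on (UNIV \<times> ES g (sing_set g)) \<nu>"
    using assms(5) unfolding concentration_measure_def by blast
  \<comment> \<open>Null sets must be measurable; this one is the trace of an open set on the
    bundle.\<close>
  moreover have "UNIV \<times> ES g \<Gamma> = (UNIV \<times> ES g (sing_set g)) \<inter> (UNIV \<times> ball \<sigma> r \<times> UNIV)"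
    by (auto simp: \<Gamma>_def ES_def)
  ultimately have meas: "UNIV \<times> ES g \<Gamma> \<in> sets \<nu>"
    unfolding positive_measure_on_def
    by (auto simp: sets_restrict_space intro!: imageI borel_open open_Times)
  have "AE z in \<nu>. \<forall>k. (\<lambda>(t, s, \<zeta>, \<omega>). r \<le> norm (L k (t, s - \<sigma>, \<zeta>))) z"
    using AE by (simp add: AE_all_countable)
  then have "AE z in \<nu>. z \<notin> UNIV \<times> ES g \<Gamma>"
  proof (rule AE_mp, intro AE_I2 impI notI)
    fix z
    assume *: "\<forall>k. (\<lambda>(t, s, \<zeta>, \<omega>). r \<le> norm (L k (t, s - \<sigma>, \<zeta>))) z" "z \<in> UNIV \<times> ES g \<Gamma>"
    obtain t s \<zeta> \<omega> where z: "z = (t, s, \<zeta>, \<omega>)"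
      by (metis prod.exhaust)
    \<comment> \<open>At a fixed point the rescaled time and momentum tend to 0, leaving the
      distance from \<open>s\<close> to \<sigma>. It would be at least \<open>r\<close>, against
      membership in the open ball.\<close>
    have "(\<lambda>k. norm (L k (t, s - \<sigma>, \<zeta>))) \<longlonglongrightarrow> norm (0::real, s - \<sigma>, 0 *\<^sub>R \<zeta>)"
      unfolding L_def split_beta fst_conv snd_conv
      by (intro tendsto_intros LIMSEQ_inverse_real_of_nat)
        (use tendsto_mult_right_zero[OF LIMSEQ_inverse_real_of_nat] in \<open>simp add: divide_inverse\<close>)
    then have "r \<le> norm (0::real, s - \<sigma>, 0 *\<^sub>R \<zeta>)"
      by (rule LIMSEQ_le_const) (use * z in auto)
    then show False
      using * z by (auto simp: \<Gamma>_def ES_def norm_Pair dist_norm norm_minus_commute)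
  qed
  then have "UNIV \<times> ES g \<Gamma> \<in> null_sets \<nu>"
    using AE_iff_null_sets[OF meas] by simp
  moreover have "openin (top_of_set (sing_set g)) \<Gamma>"
    unfolding \<Gamma>_def by (simp add: openin_open_Int)
  moreover have "\<sigma> \<in> \<Gamma>"
    using assms(6) r(1) by (simp add: \<Gamma>_def)
  ultimately show ?thesis by blast
qed

end
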